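(* The diagram $\mathcal{D}_{\mathrm{ac}}$ has no lifting, with respect to the forgetful functor from distances to $\langle\vee,0\rangle$-semilattices, by distances that are surjective at level $0$ (i.e., the distance lifting $\mathbf{2}$ is surjective) and satisfy the V-condition of type $3/2$ at level $1$ (i.e., each of the three distances lifting the semilattices $P_0,P_1,P_2$ is a V-distance of type $3/2$).
   Context: Distances. Let $S$ be a $\langle\vee,0\rangle$-semilattice and $X$ a set. A map $\delta\colon X\times X\to S$ is an $S$-valued distance on $X$ if $\delta(x,x)=0$, $\delta(x,y)=\delta(y,x)$, and $\delta(x,z)\leq\delta(x,y)\vee\delta(y,z)$ for all $x,y,z\in X$. It is a V-distance of type $3/2$ if for all $x,y\in X$ and all $a,b\in S$ with $\delta(x,y)\leq a\vee b$, there exists $z\in X$ such that either ($\delta(x,z)\leq a$ and $\delta(z,y)\leq b$) or ($\delta(x,z)\leq b$ and $\delta(z,y)\leq a$). A morphism from a distance $\lambda\colon X\times X\to A$ to a distance $\mu\colon Y\times Y\to B$ is a pair $\langle f,\boldsymbol{f}\rangle$, where $\boldsymbol{f}\colon A\to B$ is a $\langle\vee,0\rangle$-homomorphism and $f\colon X\to Y$ is a map with $\boldsymbol{f}(\lambda(x,y))=\mu(f(x),f(y))$ for all $x,y\in X$. The forgetful functor sends $\lambda\colon X\times X\to A$ to $A$ and $\langle f,\boldsymbol{f}\rangle$ to $\boldsymbol{f}$. Liftings. A diagram in a category $\mathcal{C}$ is a functor $\mathbf{D}\colon\mathcal{I}\to\mathcal{C}$; a lifting of $\mathbf{D}$ with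 respect to a functor $\mathbf{F}\colon\mathcal{A}\to\mathcal{C}$ is a functor $\Phi\colon\mathcal{I}\to\mathcal{A}$ such that $\mathbf{F}\circ\Phi$ is naturally equivalent to $\mathbf{D}$. The diagram $\mathcal{D}_{\mathrm{ac}}$. Write $n=\{0,\dots,n-1\}$ and let $\mathfrak{P}(n)$ be its powerset, viewed as a $\langle\vee,0\rangle$-semilattice under union. $\mathcal{D}_{\mathrm{ac}}$ is the commutative cube (indexed by the poset $\{0,1\}^3$) with bottom $\mathbf{2}=\{0,1\}$ (level $0$), three objects $P_0=P_1=P_2=\mathfrak{P}(2)$ (level $1$), three objects $Q_0=Q_1=Q_2=\mathfrak{P}(4)$ (level $2$), and top $\mathfrak{P}(8)$ (level $3$), and with arrows: $\boldsymbol{e}\colon\mathbf{2}\to P_i$ for $i=0,1,2$; $\boldsymbol{f}\colon P_0\to Q_2$, $\boldsymbol{f}\colon P_0\to Q_1$; $\boldsymbol{g}\colon P_1\to Q_2$, $\boldsymbol{f}\colon P_1\to Q_0$; $\boldsymbol{g}\colon P_2\to Q_1$, $\boldsymbol{g}\colon P_2\to Q_0$; $\boldsymbol{h}_i\colon Q_i\to\mathfrak{P}(8)$ for $i=0,1,2$. Here the maps are the $\langle\vee,0\rangle$-homomorphisms defined on atoms by: $\boldsymbol{e}(1)=\{0,1\}$; $\boldsymbol{f}(\{0\})=\{0,1\}$, $\boldsymbol{f}(\{1\})=\{2,3\}$; $\boldsymbol{g}(\{0\})=\{0,2\}$, $\boldsymbol{g}(\{1\})=\{1,3\}$; $\boldsymbol{h}_0$: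 $\{0\}\mapsto\{0,4,7\}$, $\{1\}\mapsto\{3,5,6\}$, $\{2\}\mapsto\{2,5,6\}$, $\{3\}\mapsto\{1,4,7\}$; $\boldsymbol{h}_1$: $\{0\}\mapsto\{0,4,5,7\}$, $\{1\}\mapsto\{1,4,6,7\}$, $\{2\}\mapsto\{2,5,6,7\}$, $\{3\}\mapsto\{3,4,5,6\}$; $\boldsymbol{h}_2$: $\{0\}\mapsto\{0,4,6\}$, $\{1\}\mapsto\{1,5,7\}$, $\{2\}\mapsto\{3,5,7\}$, $\{3\}\mapsto\{2,4,6\}$. *)

theory Defs
  imports "HOL-Algebra.Complete_Lattice" "HOL-Library.Product_Order"
begin

locale join_zero_semilattice = upper_semilattice L + weak_partial_order_bottom L
  for L (structure)

definition jz_hom :: "'a gorder \<Rightarrow> 'b gorder \<Rightarrow> ('a \<Rightarrow> 'b) set" where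
  "jz_hom A B = {h \<in> carrier A \<rightarrow> carrier B.
     h \<bottom>\<^bsub>A\<^esub> = \<bottom>\<^bsub>B\<^esub> \<and>
     (\<forall>x \<in> carrier A. \<forall>y \<in> carrier A. h (x \<squnion>\<^bsub>A\<^esub> y) = h x \<squnion>\<^bsub>B\<^esub> h y)}"

definition jz_iso :: "'a gorder \<Rightarrow> 'b gorder \<Rightarrow> ('a \<Rightarrow> 'b) set" where
  "jz_iso A B = {h \<in> jz_hom A B. bij_betw h (carrier A) (carrier B)}"

record ('x, 'a) dist_space =
  points  :: "'x set"
  semilat :: "'a gorder"
  delta   :: "'x \<Rightarrow> 'x \<Rightarrow> 'a"

locale distance =
  fixes \<Lambda> :: "('x, 'a) dist_space"
  assumes semilattice: "join_zero_semilattice (semilat \<Lambda>)"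
    and delta_closed:
      "\<lbrakk>x \<in> points \<Lambda>; y \<in> points \<Lambda>\<rbrakk> \<Longrightarrow> delta \<Lambda> x y \<in> carrier (semilat \<Lambda>)"
    and delta_self: "x \<in> points \<Lambda> \<Longrightarrow> delta \<Lambda> x x = \<bottom>\<^bsub>semilat \<Lambda>\<^esub>"
    and delta_sym:
      "\<lbrakk>x \<in> points \<Lambda>; y \<in> points \<Lambda>\<rbrakk> \<Longrightarrow> delta \<Lambda> x y = delta \<Lambda> y x"
    and delta_triangle:
      "\<lbrakk>x \<in> points \<Lambda>; y \<in> points \<Lambda>; z \<in> points \<Lambda>\<rbrakk> \<Longrightarrow>
        delta \<Lambda> x z \<sqsubseteq>\<^bsub>semilat \<Lambda>\<^esub> delta \<Lambda> x y \<squnion>\<^bsub>semilat \<Lambda>\<^esub> delta \<Lambda> y z"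

definition surjective_distance :: "('x, 'a) dist_space \<Rightarrow> bool" where
  "surjective_distance \<Lambda> \<longleftrightarrow>
     distance \<Lambda> \<and>
     (\<forall>a \<in> carrier (semilat \<Lambda>). \<exists>x \<in> points \<Lambda>. \<exists>y \<in> points \<Lambda>. delta \<Lambda> x y = a)"

definition V_distance_type_3_2 :: "('x, 'a) dist_space \<Rightarrow> bool" where
  "V_distance_type_3_2 \<Lambda> \<longleftrightarrow>
     distance \<Lambda> \<and>
     (\<forall>x \<in> points \<Lambda>. \<forall>y \<in> points \<Lambda>.
      \<forall>a \<in> carrier (semilat \<Lambda>). \<forall>b \<in> carrier (semilat \<Lambda>).
        delta \<Lambda> x y \<sqsubseteq>\<^bsub>semilat \<Lambda>\<^esub> a \<squnion>\<^bsub>semilat \<Lambda>\<^esub> b \<longrightarrow>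
        (\<exists>z \<in> points \<Lambda>.
           delta \<Lambda> x z \<sqsubseteq>\<^bsub>semilat \<Lambda>\<^esub> a \<and> delta \<Lambda> z y \<sqsubseteq>\<^bsub>semilat \<Lambda>\<^esub> b \<or>
           delta \<Lambda> x z \<sqsubseteq>\<^bsub>semilat \<Lambda>\<^esub> b \<and> delta \<Lambda> z y \<sqsubseteq>\<^bsub>semilat \<Lambda>\<^esub> a))"

definition dist_mor ::
    "('x, 'a) dist_space \<Rightarrow> ('y, 'b) dist_space \<Rightarrow> (('x \<Rightarrow> 'y) \<times> ('a \<Rightarrow> 'b)) set" where
  "dist_mor \<Lambda> M = {(f, F). f \<in> points \<Lambda> \<rightarrow> points M \<and> F \<in> jz_hom (semilat \<Lambda>) (semilat M) \<and>
     (\<forall>x \<in> points \<Lambda>. \<forall>y \<in> points \<Lambda>. F (delta \<Lambda> x y) = delta M (f x) (f y))}"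

text \<open>
  A diagram over a poset consists of its objects \<open>obj D i\<close> and its arrows
  \<open>arr D i j\<close>, the latter meaningful for \<open>i \<le> j\<close> only.  The underlying maps of
  morphisms are total functions, so two parallel morphisms are equal when they agree
  on the carriers.
\<close>

type_synonym ('i, 'o, 'm) diagram = "('i \<Rightarrow> 'o) \<times> ('i \<Rightarrow> 'i \<Rightarrow> 'm)"

abbreviation obj :: "('i, 'o, 'm) diagram \<Rightarrow> 'i \<Rightarrow> 'o" where
  "obj D \<equiv> fst D"

abbreviation arr :: "('i, 'o, 'm) diagram \<Rightarrow> 'i \<Rightarrow> 'i \<Rightarrow> 'm" where
  "arr D \<equiv> snd D"

type_synonym ('i, 'a) semilat_diagram = "('i, 'a gorder, 'a \<Rightarrow> 'a) diagram"
type_synonym ('i, 'x, 'a) dist_diagram =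
  "('i, ('x, 'a) dist_space, ('x \<Rightarrow> 'x) \<times> ('a \<Rightarrow> 'a)) diagram"

definition is_semilat_diagram :: "('i::order, 'a) semilat_diagram \<Rightarrow> bool" where
  "is_semilat_diagram D \<longleftrightarrow>
     (\<forall>i. join_zero_semilattice (obj D i)) \<and>
     (\<forall>i j. i \<le> j \<longrightarrow> arr D i j \<in> jz_hom (obj D i) (obj D j)) \<and>
     (\<forall>i. \<forall>a \<in> carrier (obj D i). arr D i i a = a) \<and>
     (\<forall>i j k. i \<le> j \<longrightarrow> j \<le> k \<longrightarrow>
        (\<forall>a \<in> carrier (obj D i). arr D j k (arr D i j a) = arr D i k a))"

definition is_dist_diagram :: "('i::order, 'x, 'a) dist_diagram \<Rightarrow> bool" where
  "is_dist_diagram \<Phi> \<longleftrightarrow>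
     (\<forall>i. distance (obj \<Phi> i)) \<and>
     (\<forall>i j. i \<le> j \<longrightarrow> arr \<Phi> i j \<in> dist_mor (obj \<Phi> i) (obj \<Phi> j)) \<and>
     (\<forall>i. (\<forall>x \<in> points (obj \<Phi> i). fst (arr \<Phi> i i) x = x) \<and>
          (\<forall>a \<in> carrier (semilat (obj \<Phi> i)). snd (arr \<Phi> i i) a = a)) \<and>
     (\<forall>i j k. i \<le> j \<longrightarrow> j \<le> k \<longrightarrow>
        (\<forall>x \<in> points (obj \<Phi> i).
           fst (arr \<Phi> j k) (fst (arr \<Phi> i j) x) = fst (arr \<Phi> i k) x) \<and>
        (\<forall>a \<in> carrier (semilat (obj \<Phi> i)).
           snd (arr \<Phi> j k) (snd (arr \<Phi> i j) a) = snd (arr \<Phi> i k) a))"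

text \<open>Composition of a diagram of distances with the forgetful functor.\<close>

definition forget :: "('i, 'x, 'a) dist_diagram \<Rightarrow> ('i, 'a) semilat_diagram" where
  "forget \<Phi> = ((\<lambda>i. semilat (obj \<Phi> i)), (\<lambda>i j. snd (arr \<Phi> i j)))"

definition naturally_equivalent ::
    "('i::order, 'a) semilat_diagram \<Rightarrow> ('i, 'b) semilat_diagram \<Rightarrow> bool" where
  "naturally_equivalent D E \<longleftrightarrow>
     (\<exists>\<eta>. (\<forall>i. \<eta> i \<in> jz_iso (obj D i) (obj E i)) \<and>
          (\<forall>i j. i \<le> j \<longrightarrow>
             (\<forall>a \<in> carrier (obj D i). \<eta> j (arr D i j a) = arr E i j (\<eta> i a))))"

definition is_lifting ::
    "('i::order, 'x, 'a) dist_diagram \<Rightarrow> ('i, 'b) semilat_diagram \<Rightarrow> bool" where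
  "is_lifting \<Phi> D \<longleftrightarrow> is_dist_diagram \<Phi> \<and> naturally_equivalent (forget \<Phi>) D"

text \<open>
  The ordering on \<open>bool \<times> bool \<times> bool\<close> is componentwise, so this is the poset
  \<open>{0,1}\<^sup>3\<close>.  The index of \<open>P\<^sub>i\<close> is the atom with \<open>i\<close>-th coordinate 1 and the index of \<open>Q\<^sub>i\<close>
  is its complement, so that there is an arrow from \<open>P\<^sub>i\<close> to \<open>Q\<^sub>j\<close> exactly when \<open>i\<close> and
  \<open>j\<close> are distinct.
\<close>

type_synonym cube = "bool \<times> bool \<times> bool"

abbreviation cube_bot :: cube where "cube_bot \<equiv> (False, False, False)"
abbreviation cube_p0  :: cube where "cube_p0  \<equiv> (True, False, False)"
abbreviation cube_p1  :: cube where "cube_p1  \<equiv> (False, True, False)"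
abbreviation cube_p2  :: cube where "cube_p2  \<equiv> (False, False, True)"
abbreviation cube_q0  :: cube where "cube_q0  \<equiv> (False, True, True)"
abbreviation cube_q1  :: cube where "cube_q1  \<equiv> (True, False, True)"
abbreviation cube_q2  :: cube where "cube_q2  \<equiv> (True, True, False)"
abbreviation cube_top :: cube where "cube_top \<equiv> (True, True, True)"

definition powerset_semilat :: "nat \<Rightarrow> nat set gorder" where
  "powerset_semilat n = \<lparr>carrier = Pow {..<n}, eq = (=), le = (\<subseteq>)\<rparr>"

text \<open>
  The union-preserving map sending the atom \<open>{i}\<close> to the \<open>i\<close>-th entry of the list.
\<close>

definition on_atoms :: "nat set list \<Rightarrow> nat set \<Rightarrow> nat set" where
  "on_atoms As S = (\<Union>i\<in>S. As ! i)"

text \<open>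
  The semilattice \<open>2 = {0,1}\<close> is the powerset of \<open>1 = {0}\<close>: its element 0 is \<open>{}\<close> and
  its element 1 is the atom \<open>{0}\<close>.
\<close>

definition ac_e :: "nat set \<Rightarrow> nat set" where
  "ac_e = on_atoms [{0, 1}]"

definition ac_f :: "nat set \<Rightarrow> nat set" where
  "ac_f = on_atoms [{0, 1}, {2, 3}]"

definition ac_g :: "nat set \<Rightarrow> nat set" where
  "ac_g = on_atoms [{0, 2}, {1, 3}]"

definition ac_h0 :: "nat set \<Rightarrow> nat set" where
  "ac_h0 = on_atoms [{0, 4, 7}, {3, 5, 6}, {2, 5, 6}, {1, 4, 7}]"

definition ac_h1 :: "nat set \<Rightarrow> nat set" where
  "ac_h1 = on_atoms [{0, 4, 5, 7}, {1, 4, 6, 7}, {2, 5, 6, 7}, {3, 4, 5, 6}]"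

definition ac_h2 :: "nat set \<Rightarrow> nat set" where
  "ac_h2 = on_atoms [{0, 4, 6}, {1, 5, 7}, {3, 5, 7}, {2, 4, 6}]"

fun ac_obj :: "cube \<Rightarrow> nat set gorder" where
  "ac_obj cube_bot = powerset_semilat 1"
| "ac_obj cube_p0  = powerset_semilat 2"
| "ac_obj cube_p1  = powerset_semilat 2"
| "ac_obj cube_p2  = powerset_semilat 2"
| "ac_obj cube_q0  = powerset_semilat 4"
| "ac_obj cube_q1  = powerset_semilat 4"
| "ac_obj cube_q2  = powerset_semilat 4"
| "ac_obj cube_top = powerset_semilat 8"

text \<open>
  The arrows that skip a level are composites along one path; the choice of the path
  is immaterial by \<open>is_semilat_diagram_D_ac\<close> below.  The default \<open>id\<close> gives the
  identities, and an irrelevant value at incomparable or decreasing pairs of indices.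
\<close>

definition ac_arr :: "cube \<Rightarrow> cube \<Rightarrow> nat set \<Rightarrow> nat set" where
  "ac_arr i j =
     (case map_of
       [((cube_bot, cube_p0), ac_e),
        ((cube_bot, cube_p1), ac_e),
        ((cube_bot, cube_p2), ac_e),
        ((cube_p0, cube_q2), ac_f),
        ((cube_p0, cube_q1), ac_f),
        ((cube_p1, cube_q2), ac_g),
        ((cube_p1, cube_q0), ac_f),
        ((cube_p2, cube_q1), ac_g),
        ((cube_p2, cube_q0), ac_g),
        ((cube_q0, cube_top), ac_h0),
        ((cube_q1, cube_top), ac_h1),
        ((cube_q2, cube_top), ac_h2),
        ((cube_bot, cube_q0), ac_f \<circ> ac_e),
        ((cube_bot, cube_q1), ac_f \<circ> ac_e),
        ((cube_bot, cube_q2), ac_f \<circ> ac_e),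
        ((cube_p0, cube_top), ac_h2 \<circ> ac_f),
        ((cube_p1, cube_top), ac_h2 \<circ> ac_g),
        ((cube_p2, cube_top), ac_h1 \<circ> ac_g),
        ((cube_bot, cube_top), ac_h2 \<circ> ac_f \<circ> ac_e)] (i, j)
      of Some h \<Rightarrow> h | None \<Rightarrow> id)"

definition D_ac :: "(cube, nat set) semilat_diagram" where
  "D_ac = (ac_obj, ac_arr)"

lemma powerset_semilat_simps [simp]:
  "carrier (powerset_semilat n) = Pow {..<n}"
  "le (powerset_semilat n) = (\<subseteq>)"
  "eq (powerset_semilat n) = (=)"
  by (simp_all add: powerset_semilat_def)

lemma join_zero_semilattice_powerset: "join_zero_semilattice (powerset_semilat n)"
proof -
  interpret complete_lattice "powerset_semilat n"
    unfolding powerset_semilat_def by (rule powerset_is_complete_lattice)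
  show ?thesis ..
qed

lemma bottom_powerset_semilat [simp]: "\<bottom>\<^bsub>powerset_semilat n\<^esub> = {}"
proof -
  interpret join_zero_semilattice "powerset_semilat n"
    by (rule join_zero_semilattice_powerset)
  have "\<bottom>\<^bsub>powerset_semilat n\<^esub> \<subseteq> {}"
    using bottom_lower[of "{}"] by simp
  then show ?thesis by simp
qed

lemma join_powerset_semilat:
  assumes "S \<subseteq> {..<n}" "T \<subseteq> {..<n}"
  shows "S \<squnion>\<^bsub>powerset_semilat n\<^esub> T = S \<union> T"
proof -
  interpret join_zero_semilattice "powerset_semilat n"
    by (rule join_zero_semilattice_powerset)
  show ?thesis
    using join_left[of S T] join_right[of S T] join_le[of S "S \<union> T" T] assms
    by auto
qed

lemma on_atoms_hom:
  assumes "m \<le> length As" "\<And>A. A \<in> set As \<Longrightarrow> A \<subseteq> {..<n}"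
  shows "on_atoms As \<in> jz_hom (powerset_semilat m) (powerset_semilat n)"
proof -
  have cl: "on_atoms As S \<subseteq> {..<n}" if "S \<subseteq> {..<m}" for S
  proof -
    have "As ! i \<subseteq> {..<n}" if "i \<in> S" for i
      using that \<open>S \<subseteq> {..<m}\<close> assms by (intro assms(2) nth_mem) auto
    then show ?thesis by (auto simp: on_atoms_def)
  qed
  then show ?thesis
    by (auto simp: jz_hom_def join_powerset_semilat) (auto simp: on_atoms_def)
qed

lemma jz_hom_comp:
  assumes "h \<in> jz_hom A B" "k \<in> jz_hom B C"
  shows "k \<circ> h \<in> jz_hom A C"
  using assms by (auto simp: jz_hom_def Pi_iff)

lemma id_jz_hom: "id \<in> jz_hom A A"
  by (auto simp: jz_hom_def)

lemma ac_homs: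
  "ac_e \<in> jz_hom (powerset_semilat (Suc 0)) (powerset_semilat 2)"
  "ac_f \<in> jz_hom (powerset_semilat 2) (powerset_semilat 4)"
  "ac_g \<in> jz_hom (powerset_semilat 2) (powerset_semilat 4)"
  "ac_h0 \<in> jz_hom (powerset_semilat 4) (powerset_semilat 8)"
  "ac_h1 \<in> jz_hom (powerset_semilat 4) (powerset_semilat 8)"
  "ac_h2 \<in> jz_hom (powerset_semilat 4) (powerset_semilat 8)"
  unfolding ac_e_def ac_f_def ac_g_def ac_h0_def ac_h1_def ac_h2_def
  by (rule on_atoms_hom; force)+

lemma on_atoms_comp:
  assumes "S \<subseteq> {..<length As}"
  shows "on_atoms Bs (on_atoms As S) = on_atoms (map (on_atoms Bs) As) S"
proof -
  have "on_atoms (map (on_atoms Bs) As) S = (\<Union>i\<in>S. on_atoms Bs (As ! i))"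
    unfolding on_atoms_def[of "map _ _"] using assms by (intro SUP_cong) auto
  then show ?thesis by (auto simp: on_atoms_def)
qed

lemma on_atoms_comp_eq:
  assumes "map (on_atoms Bs) As = map (on_atoms Bs') As'" "S \<subseteq> {..<length As}"
  shows "on_atoms Bs (on_atoms As S) = on_atoms Bs' (on_atoms As' S)"
  using assms map_eq_imp_length_eq[OF assms(1)] by (simp add: on_atoms_comp)

lemma ac_commute:
  "S \<subseteq> {..<Suc 0} \<Longrightarrow> ac_g (ac_e S) = ac_f (ac_e S)"
  "S \<subseteq> {..<2} \<Longrightarrow> ac_h1 (ac_f S) = ac_h2 (ac_f S)"
  "S \<subseteq> {..<2} \<Longrightarrow> ac_h0 (ac_f S) = ac_h2 (ac_g S)"
  "S \<subseteq> {..<2} \<Longrightarrow> ac_h0 (ac_g S) = ac_h1 (ac_g S)"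
  unfolding ac_e_def ac_f_def ac_g_def ac_h0_def ac_h1_def ac_h2_def
  by (rule on_atoms_comp_eq; force simp: on_atoms_def)+

lemma cube_cases:
  obtains "i = cube_bot" | "i = cube_p0" | "i = cube_p1" | "i = cube_p2"
    | "i = cube_q0" | "i = cube_q1" | "i = cube_q2" | "i = cube_top"
  by (cases i rule: prod_cases3) auto

lemma is_semilat_diagram_D_ac: "is_semilat_diagram D_ac"
proof -
  note homs = ac_homs id_jz_hom jz_hom_comp
  have objs: "join_zero_semilattice (ac_obj i)" for i
    by (cases i rule: cube_cases) (simp_all add: join_zero_semilattice_powerset)
  have arrs: "ac_arr i j \<in> jz_hom (ac_obj i) (ac_obj j)" if "i \<le> j" for i j
    using that
    by (cases i rule: cube_cases; cases j rule: cube_cases)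
       (simp_all add: ac_arr_def less_eq_prod_def, (blast intro: homs)+)
  have ids: "ac_arr i i a = a" for i a
    by (cases i rule: cube_cases) (simp_all add: ac_arr_def)
  have e: "ac_e a \<subseteq> {..<2}" if "a \<subseteq> {..<Suc 0}" for a
    using ac_homs(1) that by (auto simp: jz_hom_def Pi_iff)
  have comp: "ac_arr j k (ac_arr i j a) = ac_arr i k a"
    if "i \<le> j" "j \<le> k" "a \<in> carrier (ac_obj i)" for i j k a
    using that
    by (cases i rule: cube_cases; cases j rule: cube_cases; simp add: less_eq_prod_def;
        cases k rule: cube_cases; simp add: less_eq_prod_def; simp add: ac_arr_def ac_commute e)
  show ?thesis
    using objs arrs ids comp by (simp add: is_semilat_diagram_def D_ac_def)
qed

end

theory Submission
  imports Defs
begin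

text \<open>
  Suppose that a lifting exists, and identify its semilattices with those of the diagram.
  Surjectivity at the bottom gives points \<open>x\<close> and \<open>y\<close> at distance \<open>1\<close>; their images in the
  three distances over \<open>P\<^sub>0\<close>, \<open>P\<^sub>1\<close>, \<open>P\<^sub>2\<close> are at distance \<open>{0,1} = {0} \<union> {1}\<close>.  The V-condition
  of type \<open>3/2\<close> splits this distance at a point \<open>z\<^sub>i\<close>, and the triangle inequality leaves only
  two possibilities: \<open>x\<close> is at distance \<open>{k}\<close> from \<open>z\<^sub>i\<close> and \<open>z\<^sub>i\<close> at distance \<open>{1 - k}\<close> from \<open>y\<close>,
  with \<open>k\<close> either \<open>0\<close> or \<open>1\<close> (\<open>complementary_midpoint\<close>).  So each \<open>z\<^sub>i\<close> has an orientation
  \<open>k\<^sub>i\<close>, over which there is no control.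

  The orientations determine the distances between the three midpoints.  In the distance over
  \<open>Q\<^sub>j\<close>, the images of the two midpoints that live there split the same distance from \<open>x\<close> to \<open>y\<close>,
  namely the whole set \<open>4\<close>, into disjoint parts; this forces the distance between them to be
  the symmetric difference of their distances from \<open>x\<close> (\<open>delta_midpoints\<close>).  By the choice of
  \<open>f\<close> and \<open>g\<close> this is \<open>{1,2}\<close> if the two orientations agree and \<open>{0,3}\<close> otherwise.

  Applying \<open>h\<^sub>0\<close>, \<open>h\<^sub>1\<close>, \<open>h\<^sub>2\<close> gives the three distances \<open>\<delta>(z\<^sub>1,z\<^sub>2)\<close>, \<open>\<delta>(z\<^sub>0,z\<^sub>2)\<close>,
  \<open>\<delta>(z\<^sub>0,z\<^sub>1)\<close> in the top set \<open>8\<close>, and these maps are designed so that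
  \<open>\<delta>(z\<^sub>0,z\<^sub>2) \<subseteq> \<delta>(z\<^sub>0,z\<^sub>1) \<union> \<delta>(z\<^sub>1,z\<^sub>2)\<close> fails whatever the orientations are.  Up to exchanging \<open>x\<close> and
  \<open>y\<close> there are four cases.  The element of \<open>\<delta>(z\<^sub>0,z\<^sub>2)\<close> missing on the right is \<open>4\<close> if all
  orientations agree, and \<open>7\<close>, \<open>5\<close>, \<open>6\<close> if \<open>k\<^sub>0\<close>, \<open>k\<^sub>1\<close>, \<open>k\<^sub>2\<close>, respectively, is the odd one out.
\<close>

section \<open>Transport of distances along semilattice isomorphisms\<close>

lemma (in join_zero_semilattice) le_iff_join_eq:
  assumes "a \<in> carrier L" "b \<in> carrier L"
  shows "a \<sqsubseteq> b \<longleftrightarrow> a \<squnion> b = b"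
proof
  assume "a \<sqsubseteq> b"
  then show "a \<squnion> b = b"
    using assms by (intro le_antisym) (simp_all add: join_le join_right)
next
  assume "a \<squnion> b = b"
  then show "a \<sqsubseteq> b"
    using assms join_left[of a b] by simp
qed

lemma jz_isoD:
  assumes "h \<in> jz_iso A B"
  shows "a \<in> carrier A \<Longrightarrow> h a \<in> carrier B"
    and "h \<bottom>\<^bsub>A\<^esub> = \<bottom>\<^bsub>B\<^esub>"
    and "a \<in> carrier A \<Longrightarrow> b \<in> carrier A \<Longrightarrow> h (a \<squnion>\<^bsub>A\<^esub> b) = h a \<squnion>\<^bsub>B\<^esub> h b"
    and "inj_on h (carrier A)"
    and "h ` carrier A = carrier B"
  using assms by (auto simp: jz_iso_def jz_hom_def bij_betw_def)

text \<open>The order of a join-semilattice is determined by its join.\<close>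

lemma jz_iso_le_iff:
  assumes "join_zero_semilattice A" "join_zero_semilattice B" "h \<in> jz_iso A B"
    and "a \<in> carrier A" "b \<in> carrier A"
  shows "h a \<sqsubseteq>\<^bsub>B\<^esub> h b \<longleftrightarrow> a \<sqsubseteq>\<^bsub>A\<^esub> b"
proof -
  interpret A: join_zero_semilattice A by fact
  interpret B: join_zero_semilattice B by fact
  note h = jz_isoD[OF assms(3)]
  have "h a \<sqsubseteq>\<^bsub>B\<^esub> h b \<longleftrightarrow> h (a \<squnion>\<^bsub>A\<^esub> b) = h b"
    using assms h by (simp add: B.le_iff_join_eq)
  also have "\<dots> \<longleftrightarrow> a \<squnion>\<^bsub>A\<^esub> b = b"
    using assms h(4) by (simp add: inj_on_eq_iff)
  finally show ?thesis
    using assms by (simp add: A.le_iff_join_eq)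
qed

definition transport :: "('a \<Rightarrow> 'b) \<Rightarrow> 'b gorder \<Rightarrow> ('x, 'a) dist_space \<Rightarrow> ('x, 'b) dist_space" where
  "transport h B \<Lambda> = \<lparr>points = points \<Lambda>, semilat = B, delta = (\<lambda>x y. h (delta \<Lambda> x y))\<rparr>"

lemma transport_simps [simp]:
  "points (transport h B \<Lambda>) = points \<Lambda>"
  "semilat (transport h B \<Lambda>) = B"
  "delta (transport h B \<Lambda>) x y = h (delta \<Lambda> x y)"
  by (simp_all add: transport_def)

lemma distance_transport:
  assumes "distance \<Lambda>" "join_zero_semilattice B" "h \<in> jz_iso (semilat \<Lambda>) B"
  shows "distance (transport h B \<Lambda>)"
proof -
  interpret distance \<Lambda> by fact
  interpret A: join_zero_semilattice "semilat \<Lambda>" by (rule semilattice)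
  note h = jz_isoD[OF assms(3)] and le = jz_iso_le_iff[OF semilattice assms(2,3)]
  show ?thesis
  proof (rule distance.intro)
    fix x y z
    assume "x \<in> points (transport h B \<Lambda>)" "y \<in> points (transport h B \<Lambda>)"
      "z \<in> points (transport h B \<Lambda>)"
    then show "delta (transport h B \<Lambda>) x z
        \<sqsubseteq>\<^bsub>semilat (transport h B \<Lambda>)\<^esub> delta (transport h B \<Lambda>) x y
        \<squnion>\<^bsub>semilat (transport h B \<Lambda>)\<^esub> delta (transport h B \<Lambda>) y z"
      using delta_triangle[of x y z] by (simp add: delta_closed h(3)[symmetric] le)
  qed (use assms(2) h in \<open>auto simp: delta_closed delta_self delta_sym\<close>)
qed

lemma surjective_distance_transport:
  assumes "surjective_distance \<Lambda>" "join_zero_semilattice B" "h \<in> jz_iso (semilat \<Lambda>) B"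
  shows "surjective_distance (transport h B \<Lambda>)"
proof -
  have "\<exists>x \<in> points \<Lambda>. \<exists>y \<in> points \<Lambda>. h (delta \<Lambda> x y) = b" if b: "b \<in> carrier B" for b
  proof -
    obtain a where "a \<in> carrier (semilat \<Lambda>)" "b = h a"
      using b jz_isoD(5)[OF assms(3)] by blast
    moreover then obtain x y where "x \<in> points \<Lambda>" "y \<in> points \<Lambda>" "delta \<Lambda> x y = a"
      using assms(1) unfolding surjective_distance_def by blast
    ultimately show ?thesis
      by blast
  qed
  then show ?thesis
    using assms distance_transport by (auto simp: surjective_distance_def)
qed

lemma V_distance_type_3_2_transport:
  assumes V: "V_distance_type_3_2 \<Lambda>" and B: "join_zero_semilattice B"
    and iso: "h \<in> jz_iso (semilat \<Lambda>) B"
  shows "V_distance_type_3_2 (transport h B \<Lambda>)"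
proof -
  interpret distance \<Lambda> using V by (simp add: V_distance_type_3_2_def)
  interpret A: join_zero_semilattice "semilat \<Lambda>" by (rule semilattice)
  note h = jz_isoD[OF iso] and le = jz_iso_le_iff[OF semilattice B iso]
  have "\<exists>z \<in> points \<Lambda>. h (delta \<Lambda> x z) \<sqsubseteq>\<^bsub>B\<^esub> a \<and> h (delta \<Lambda> z y) \<sqsubseteq>\<^bsub>B\<^esub> b \<or>
      h (delta \<Lambda> x z) \<sqsubseteq>\<^bsub>B\<^esub> b \<and> h (delta \<Lambda> z y) \<sqsubseteq>\<^bsub>B\<^esub> a"
    if xy: "x \<in> points \<Lambda>" "y \<in> points \<Lambda>" and ab: "a \<in> carrier B" "b \<in> carrier B"
      and split: "h (delta \<Lambda> x y) \<sqsubseteq>\<^bsub>B\<^esub> a \<squnion>\<^bsub>B\<^esub> b" for x y a b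
  proof -
    obtain a' b' where ab': "a' \<in> carrier (semilat \<Lambda>)" "b' \<in> carrier (semilat \<Lambda>)"
      and [simp]: "a = h a'" "b = h b'"
      using ab h(5) by blast
    have "delta \<Lambda> x y \<sqsubseteq>\<^bsub>semilat \<Lambda>\<^esub> a' \<squnion>\<^bsub>semilat \<Lambda>\<^esub> b'"
      using split ab' xy by (simp add: delta_closed h(3)[symmetric] le)
    then obtain z where "z \<in> points \<Lambda>"
      "delta \<Lambda> x z \<sqsubseteq>\<^bsub>semilat \<Lambda>\<^esub> a' \<and> delta \<Lambda> z y \<sqsubseteq>\<^bsub>semilat \<Lambda>\<^esub> b' \<or>
       delta \<Lambda> x z \<sqsubseteq>\<^bsub>semilat \<Lambda>\<^esub> b' \<and> delta \<Lambda> z y \<sqsubseteq>\<^bsub>semilat \<Lambda>\<^esub> a'"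
      using V xy ab' unfolding V_distance_type_3_2_def by blast
    then show ?thesis
      using xy ab' by (intro bexI[of _ z]) (simp_all add: delta_closed le)
  qed
  then show ?thesis
    using distance_transport[OF distance_axioms B iso] by (simp add: V_distance_type_3_2_def)
qed

section \<open>Distances with values in a powerset\<close>

lemma powerset_distanceD:
  assumes "distance \<Lambda>" "semilat \<Lambda> = powerset_semilat n"
    and "x \<in> points \<Lambda>" "y \<in> points \<Lambda>"
  shows "delta \<Lambda> x y = delta \<Lambda> y x"
    and "z \<in> points \<Lambda> \<Longrightarrow> delta \<Lambda> x z \<subseteq> delta \<Lambda> x y \<union> delta \<Lambda> y z"
proof -
  interpret distance \<Lambda> by fact
  show "delta \<Lambda> x y = delta \<Lambda> y x"
    using assms by (simp add: delta_sym)
  show "delta \<Lambda> x z \<subseteq> delta \<Lambda> x y \<union> delta \<Lambda> y z" if "z \<in> points \<Lambda>"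
    using delta_triangle[of x y z] delta_closed[of x y] delta_closed[of y z] that assms
    by (simp add: join_powerset_semilat)
qed

lemma complementary_midpoint:
  assumes V: "V_distance_type_3_2 \<Lambda>" and \<Lambda>: "semilat \<Lambda> = powerset_semilat 2"
    and xy: "x \<in> points \<Lambda>" "y \<in> points \<Lambda>" and d: "delta \<Lambda> x y = {0, 1}"
  obtains z k where "z \<in> points \<Lambda>" "k \<in> {0, 1}" "delta \<Lambda> x z = {k}" "delta \<Lambda> z y = {1 - k}"
proof -
  have dist: "distance \<Lambda>"
    using V by (simp add: V_distance_type_3_2_def)
  have "{0::nat} \<in> Pow {..<2}" "{1::nat} \<in> Pow {..<2}"
    by auto
  moreover from this have "delta \<Lambda> x y \<subseteq> {0} \<squnion>\<^bsub>powerset_semilat 2\<^esub> {1}"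
    using d by (simp add: join_powerset_semilat)
  ultimately obtain z where z: "z \<in> points \<Lambda>"
    "delta \<Lambda> x z \<subseteq> {0} \<and> delta \<Lambda> z y \<subseteq> {1} \<or> delta \<Lambda> x z \<subseteq> {1} \<and> delta \<Lambda> z y \<subseteq> {0}"
    using V xy \<Lambda> unfolding V_distance_type_3_2_def
    by (metis powerset_semilat_simps(1,2))
  \<comment> \<open>The two sides together cover \<open>{0, 1}\<close>, so the inclusions are equalities.\<close>
  have "{0, 1} \<subseteq> delta \<Lambda> x z \<union> delta \<Lambda> z y"
    using powerset_distanceD(2)[OF dist \<Lambda>, of x z y] xy z(1) d by simp
  with z(2) have "delta \<Lambda> x z = {0} \<and> delta \<Lambda> z y = {1} \<or> delta \<Lambda> x z = {1} \<and> delta \<Lambda> z y = {0}"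
    by (simp add: subset_singleton_iff) auto
  then show thesis
    using z(1) that[of z 0] that[of z 1] by auto
qed

text \<open>
  Each of \<open>A\<close> and \<open>B\<close> is covered by the other together with \<open>\<delta>(z,w)\<close>, so \<open>\<delta>(z,w)\<close> contains
  their symmetric difference.  Conversely, going from \<open>z\<close> to \<open>w\<close> through \<open>x\<close> excludes from
  \<open>\<delta>(z,w)\<close> the elements outside \<open>A\<close> and \<open>B\<close>, and going through \<open>y\<close> excludes those in \<open>A \<inter> B\<close>.
\<close>

lemma delta_midpoints:
  assumes dist: "distance \<Lambda>" "semilat \<Lambda> = powerset_semilat n"
    and pts: "x \<in> points \<Lambda>" "y \<in> points \<Lambda>" "z \<in> points \<Lambda>" "w \<in> points \<Lambda>"
    and z: "delta \<Lambda> x z = A" "delta \<Lambda> z y = A'" "A \<inter> A' = {}"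
    and w: "delta \<Lambda> x w = B" "delta \<Lambda> w y = B'" "B \<inter> B' = {}"
  shows "delta \<Lambda> z w = (A - B) \<union> (B - A)"
proof -
  note sym = powerset_distanceD(1)[OF dist] and tri = powerset_distanceD(2)[OF dist]
  have "A \<subseteq> B \<union> delta \<Lambda> z w"
    using tri[of x w z] sym[of w z] pts z w by simp
  moreover have "B \<subseteq> A \<union> delta \<Lambda> z w"
    using tri[of x z w] pts z w by simp
  moreover have "delta \<Lambda> z w \<subseteq> A \<union> B"
    using tri[of z x w] sym[of z x] pts z w by simp
  moreover have "delta \<Lambda> z w \<subseteq> A' \<union> B'"
    using tri[of z y w] sym[of y w] pts z w by simp
  ultimately show ?thesis
    using z(3) w(3) by blast
qed

section \<open>The diagram has no lifting\<close>

text \<open>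
  Distances lifting a diagram only up to natural equivalence can be replaced by distances over
  the semilattices of the diagram itself, with the same maps between the sets of points.
\<close>

lemma is_lifting_strictE:
  fixes \<Phi> :: "('i::order, 'x, 'a) dist_diagram" and D :: "('i, 'b) semilat_diagram"
  assumes lift: "is_lifting \<Phi> D" and D: "is_semilat_diagram D"
  obtains T :: "'i \<Rightarrow> ('x, 'b) dist_space" and m :: "'i \<Rightarrow> 'i \<Rightarrow> 'x \<Rightarrow> 'x"
  where "\<And>i. distance (T i)" and "\<And>i. semilat (T i) = obj D i"
    and "\<And>i. surjective_distance (obj \<Phi> i) \<Longrightarrow> surjective_distance (T i)"
    and "\<And>i. V_distance_type_3_2 (obj \<Phi> i) \<Longrightarrow> V_distance_type_3_2 (T i)"
    and "\<And>i j x. \<lbrakk>i \<le> j; x \<in> points (T i)\<rbrakk> \<Longrightarrow> m i j x \<in> points (T j)"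
    and "\<And>i j k x. \<lbrakk>i \<le> j; j \<le> k; x \<in> points (T i)\<rbrakk> \<Longrightarrow> m j k (m i j x) = m i k x"
    and "\<And>i j x y. \<lbrakk>i \<le> j; x \<in> points (T i); y \<in> points (T i)\<rbrakk> \<Longrightarrow>
      delta (T j) (m i j x) (m i j y) = arr D i j (delta (T i) x y)"
proof -
  have diagram: "is_dist_diagram \<Phi>"
    using lift by (simp add: is_lifting_def)
  obtain \<eta> where iso: "\<And>i. \<eta> i \<in> jz_iso (semilat (obj \<Phi> i)) (obj D i)"
    and nat: "\<And>i j a. \<lbrakk>i \<le> j; a \<in> carrier (semilat (obj \<Phi> i))\<rbrakk> \<Longrightarrow>
      \<eta> j (snd (arr \<Phi> i j) a) = arr D i j (\<eta> i a)"
    using lift unfolding is_lifting_def naturally_equivalent_def forget_def fst_conv snd_conv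
    by blast
  have jzs: "join_zero_semilattice (obj D i)" for i
    using D by (simp add: is_semilat_diagram_def)
  have dist: "distance (obj \<Phi> i)" for i
    using diagram by (simp add: is_dist_diagram_def)
  have mor: "arr \<Phi> i j \<in> dist_mor (obj \<Phi> i) (obj \<Phi> j)" if "i \<le> j" for i j
    using diagram that by (simp add: is_dist_diagram_def)
  define T where "T i = transport (\<eta> i) (obj D i) (obj \<Phi> i)" for i
  define m where "m i j = fst (arr \<Phi> i j)" for i j
  show thesis
  proof (rule that)
    show "distance (T i)" for i
      unfolding T_def by (rule distance_transport[OF dist jzs iso])
    show "semilat (T i) = obj D i" for i
      by (simp add: T_def)
    show "surjective_distance (T i)" if "surjective_distance (obj \<Phi> i)" for i
      unfolding T_def by (rule surjective_distance_transport[OF that jzs iso])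
    show "V_distance_type_3_2 (T i)" if "V_distance_type_3_2 (obj \<Phi> i)" for i
      unfolding T_def by (rule V_distance_type_3_2_transport[OF that jzs iso])
    show "m i j x \<in> points (T j)" if "i \<le> j" "x \<in> points (T i)" for i j x
      using mor[OF that(1)] that(2) by (auto simp: dist_mor_def T_def m_def)
    show "m j k (m i j x) = m i k x" if "i \<le> j" "j \<le> k" "x \<in> points (T i)" for i j k x
      using diagram that by (simp add: is_dist_diagram_def T_def m_def)
    show "delta (T j) (m i j x) (m i j y) = arr D i j (delta (T i) x y)"
      if "i \<le> j" "x \<in> points (T i)" "y \<in> points (T i)" for i j x y
      using mor[OF that(1)] that nat[OF that(1), of "delta (obj \<Phi> i) x y"]
        distance.delta_closed[OF dist, of x i y]
      by (auto simp: dist_mor_def T_def m_def)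
  qed
qed

theorem theorem7p2:
  shows "\<not> (\<exists>\<Phi> :: (cube, 'x, 'a) dist_diagram.
            is_lifting \<Phi> D_ac \<and>
            surjective_distance (obj \<Phi> cube_bot) \<and>
            (\<forall>i \<in> {cube_p0, cube_p1, cube_p2}. V_distance_type_3_2 (obj \<Phi> i)))"
proof
  assume "\<exists>\<Phi> :: (cube, 'x, 'a) dist_diagram.
            is_lifting \<Phi> D_ac \<and>
            surjective_distance (obj \<Phi> cube_bot) \<and>
            (\<forall>i \<in> {cube_p0, cube_p1, cube_p2}. V_distance_type_3_2 (obj \<Phi> i))"
  then obtain \<Phi> :: "(cube, 'x, 'a) dist_diagram" where lift: "is_lifting \<Phi> D_ac"
    and surj: "surjective_distance (obj \<Phi> cube_bot)"
    and V: "\<And>i. i \<in> {cube_p0, cube_p1, cube_p2} \<Longrightarrow> V_distance_type_3_2 (obj \<Phi> i)"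
    by blast
  obtain T :: "cube \<Rightarrow> ('x, nat set) dist_space" and m :: "cube \<Rightarrow> cube \<Rightarrow> 'x \<Rightarrow> 'x"
    where T: "\<And>i. distance (T i)" "\<And>i. semilat (T i) = ac_obj i"
      and surj_T: "\<And>i. surjective_distance (obj \<Phi> i) \<Longrightarrow> surjective_distance (T i)"
      and V_T: "\<And>i. V_distance_type_3_2 (obj \<Phi> i) \<Longrightarrow> V_distance_type_3_2 (T i)"
      and m_closed: "\<And>i j u. \<lbrakk>i \<le> j; u \<in> points (T i)\<rbrakk> \<Longrightarrow> m i j u \<in> points (T j)"
      and m_comp: "\<And>i j k u. \<lbrakk>i \<le> j; j \<le> k; u \<in> points (T i)\<rbrakk> \<Longrightarrow> m j k (m i j u) = m i k u"
      and m_delta: "\<And>i j u v. \<lbrakk>i \<le> j; u \<in> points (T i); v \<in> points (T i)\<rbrakk> \<Longrightarrow>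
        delta (T j) (m i j u) (m i j v) = ac_arr i j (delta (T i) u v)"
    by (rule is_lifting_strictE[OF lift is_semilat_diagram_D_ac, unfolded D_ac_def fst_conv snd_conv])
      blast

  have "{0} \<in> carrier (semilat (T cube_bot))"
    by (simp add: T)
  then obtain x y where xy: "x \<in> points (T cube_bot)" "y \<in> points (T cube_bot)"
    "delta (T cube_bot) x y = {0}"
    using surj_T[OF surj] unfolding surjective_distance_def by blast
  have bot_le: "cube_bot \<le> i" for i :: cube
    by (simp add: less_eq_prod_def)

  have mid: "\<exists>z k. z \<in> points (T p) \<and> k \<in> {0, 1} \<and>
      delta (T p) (m cube_bot p x) z = {k} \<and> delta (T p) z (m cube_bot p y) = {1 - k}"
    if p: "p \<in> {cube_p0, cube_p1, cube_p2}" for p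
  proof -
    have "V_distance_type_3_2 (T p)"
      by (rule V_T[OF V[OF p]])
    moreover have "semilat (T p) = powerset_semilat 2"
      using p by (auto simp: T)
    moreover have "delta (T p) (m cube_bot p x) (m cube_bot p y) = {0, 1}"
      using p xy by (auto simp: m_delta bot_le ac_arr_def ac_e_def on_atoms_def)
    ultimately obtain z k where "z \<in> points (T p)" "k \<in> {0, 1}"
      "delta (T p) (m cube_bot p x) z = {k}" "delta (T p) z (m cube_bot p y) = {1 - k}"
      using m_closed[OF bot_le] xy
      by (elim complementary_midpoint[of "T p" "m cube_bot p x" "m cube_bot p y"]) auto
    then show ?thesis
      by blast
  qed
  obtain z0 k0 where z0: "z0 \<in> points (T cube_p0)" "k0 \<in> {0, 1}"
      "delta (T cube_p0) (m cube_bot cube_p0 x) z0 = {k0}"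
      "delta (T cube_p0) z0 (m cube_bot cube_p0 y) = {1 - k0}"
    using mid[of cube_p0] by blast
  obtain z1 k1 where z1: "z1 \<in> points (T cube_p1)" "k1 \<in> {0, 1}"
      "delta (T cube_p1) (m cube_bot cube_p1 x) z1 = {k1}"
      "delta (T cube_p1) z1 (m cube_bot cube_p1 y) = {1 - k1}"
    using mid[of cube_p1] by blast
  obtain z2 k2 where z2: "z2 \<in> points (T cube_p2)" "k2 \<in> {0, 1}"
      "delta (T cube_p2) (m cube_bot cube_p2 x) z2 = {k2}"
      "delta (T cube_p2) z2 (m cube_bot cube_p2 y) = {1 - k2}"
    using mid[of cube_p2] by blast

  \<comment> \<open>The distance of two midpoints at the top comes from a face of the cube: it is computed in the
    distance over \<open>q\<close>, where both midpoints have images, and then mapped up.\<close>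
  have face: "delta (T cube_top) (m p cube_top z) (m p' cube_top z') =
      ac_arr q cube_top ((ac_arr p q {k} - ac_arr p' q {k'}) \<union> (ac_arr p' q {k'} - ac_arr p q {k}))"
    if le: "p \<le> q" "p' \<le> q" and q: "ac_obj q = powerset_semilat 4"
      and z: "z \<in> points (T p)" "delta (T p) (m cube_bot p x) z = {k}"
        "delta (T p) z (m cube_bot p y) = {1 - k}"
      and z': "z' \<in> points (T p')" "delta (T p') (m cube_bot p' x) z' = {k'}"
        "delta (T p') z' (m cube_bot p' y) = {1 - k'}"
      and disj: "ac_arr p q {k} \<inter> ac_arr p q {1 - k} = {}"
        "ac_arr p' q {k'} \<inter> ac_arr p' q {1 - k'} = {}"
    for p p' q z z' k k'
  proof -
    have top: "q \<le> cube_top"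
      by (simp add: less_eq_prod_def)
    have sides: "delta (T q) (m cube_bot q x) (m r q v) = ac_arr r q (delta (T r) (m cube_bot r x) v)"
      "delta (T q) (m r q v) (m cube_bot q y) = ac_arr r q (delta (T r) v (m cube_bot r y))"
      if "r \<le> q" "v \<in> points (T r)" for r v
      using m_delta[OF that(1) m_closed[OF bot_le xy(1)] that(2)]
        m_delta[OF that m_closed[OF bot_le xy(2)]] m_comp[OF bot_le that(1)] xy by simp_all
    have "delta (T q) (m p q z) (m p' q z') =
        (ac_arr p q {k} - ac_arr p' q {k'}) \<union> (ac_arr p' q {k'} - ac_arr p q {k})"
      by (rule delta_midpoints[of "T q" 4 "m cube_bot q x" "m cube_bot q y"
            _ _ _ "ac_arr p q {1 - k}" _ "ac_arr p' q {1 - k'}"])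
        (use le q z z' disj xy bot_le in \<open>simp_all add: T m_closed sides\<close>)
    then show ?thesis
      using m_delta[OF top m_closed[OF le(1) z(1)] m_closed[OF le(2) z'(1)]]
        m_comp[OF le(1) top z(1)] m_comp[OF le(2) top z'(1)] by simp
  qed

  define t0 t1 t2 where "t0 = m cube_p0 cube_top z0" and "t1 = m cube_p1 cube_top z1"
    and "t2 = m cube_p2 cube_top z2"
  have disj: "ac_f {k} \<inter> ac_f {1 - k} = {}" "ac_g {k} \<inter> ac_g {1 - k} = {}" if "k \<in> {0, 1}" for k
    using that by (auto simp: ac_f_def ac_g_def on_atoms_def)
  have arrow_sym_diff:
    "(ac_f {k} - ac_g {k'}) \<union> (ac_g {k'} - ac_f {k}) = (if k = k' then {1, 2} else {0, 3})"
    if "k \<in> {0, 1}" "k' \<in> {0, 1}" for k k'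
    using that by (auto simp: ac_f_def ac_g_def on_atoms_def)
  have d01: "delta (T cube_top) t0 t1 = ac_h2 (if k0 = k1 then {1, 2} else {0, 3})"
    using face[of cube_p0 cube_q2 cube_p1 z0 k0 z1 k1] z0 z1 disj arrow_sym_diff
    by (simp add: t0_def t1_def ac_arr_def less_eq_prod_def)
  have d02: "delta (T cube_top) t0 t2 = ac_h1 (if k0 = k2 then {1, 2} else {0, 3})"
    using face[of cube_p0 cube_q1 cube_p2 z0 k0 z2 k2] z0 z2 disj arrow_sym_diff
    by (simp add: t0_def t2_def ac_arr_def less_eq_prod_def)
  have d12: "delta (T cube_top) t1 t2 = ac_h0 (if k1 = k2 then {1, 2} else {0, 3})"
    using face[of cube_p1 cube_q0 cube_p2 z1 k1 z2 k2] z1 z2 disj arrow_sym_diff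
    by (simp add: t1_def t2_def ac_arr_def less_eq_prod_def)

  have "delta (T cube_top) t0 t2 \<subseteq> delta (T cube_top) t0 t1 \<union> delta (T cube_top) t1 t2"
    using z0 z1 z2
    by (intro powerset_distanceD(2)[OF T(1), of _ 8])
      (auto simp: T t0_def t1_def t2_def less_eq_prod_def intro!: m_closed)
  \<comment> \<open>In each of the eight cases one of the elements 4, 5, 6, 7 violates this inclusion.\<close>
  then show False
    using z0(2) z1(2) z2(2) unfolding d01 d02 d12
    by (auto simp: ac_h0_def ac_h1_def ac_h2_def on_atoms_def)
qed

end
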